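(* Let $\mathbb{K}$ be a field, $n\geq 2$ and $k\geq 1$ natural numbers, and $p=k(n-1)+1$. Let $\mathcal{P}$ and $\mathcal{L}$ be Leibniz $n$-algebras over $\mathbb{K}$ and suppose $\mathcal{P}$ acts on $\mathcal{L}$. Then the Leibniz $p$-algebra $\mathfrak{U}_n^p(\mathcal{P})$ acts on the Leibniz $p$-algebra $\mathfrak{U}_n^p(\mathcal{L})$.
   Context: A Leibniz $n$-algebra over a field $\mathbb{K}$ is a vector space $\mathcal{L}$ with an $n$-linear operation $[-,\dots,-]:\mathcal{L}^{\otimes n}\to\mathcal{L}$ satisfying the fundamental identity \[ [[x_1,\dots,x_n],y_2,\dots,y_n]=\sum_{i=1}^n[x_1,\dots,x_{i-1},[x_i,y_2,\dots,y_n],x_{i+1},\dots,x_n]. \] For a Leibniz $n$-algebra $\mathcal{L}$, $\mathfrak{U}_n^p(\mathcal{L})$ is the Leibniz $p$-algebra with the same vector space $\mathcal{L}$ and $p$-ary bracket $[l_1,\dots,l_p]=[l_1,\dots,l_{n-1},[l_n,\dots,l_{2n-2},[\dots,[l_{p-n+1},\dots,l_p]\dots]]]$ ($k$ nested $n$-ary brackets; it is known that this is a Leibniz $p$-algebra). Action: a Leibniz $n$-algebra $\mathcal{P}$ acts on a Leibniz $n$-algebra $\mathcal{L}$ if there are given $2^n-2$ $n$-linear maps $[-,\dots,-]:A_1\otimes\cdots\otimes A_n\to\mathcal{L}$, one for each choice of $A_1,\dots,A_n\in\{\mathcal{L},\mathcal{P}\}$ in which both $\mathcal{L}$ and $\mathcal{P}$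 occur, such that the $2^{2n-1}-2$ equalities hold which are obtained from the fundamental identity by taking each of the $2n-1$ variables $x_1,\dots,x_n,y_2,\dots,y_n$ in $\mathcal{L}$ or $\mathcal{P}$, in all ways in which at least one variable lies in $\mathcal{L}$ and at least one lies in $\mathcal{P}$ (brackets with all entries in $\mathcal{L}$, respectively $\mathcal{P}$, are those of the algebra $\mathcal{L}$, respectively $\mathcal{P}$; all mixed brackets take values in $\mathcal{L}$). The same definition with $p$ in place of $n$ gives the notion of action for Leibniz $p$-algebras. *)

theory Defs
  imports Complex_Main
begin

text \<open>An operation of arity n is a function on lists, considered only on lists of length n.\<close>

definition multilinear :: "nat \<Rightarrow> ('k::field \<Rightarrow> 'a::ab_group_add \<Rightarrow> 'a) \<Rightarrow> ('a list \<Rightarrow> 'a) \<Rightarrow> bool" where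
  "multilinear n s b \<longleftrightarrow>
     (\<forall>xs i. length xs = n \<longrightarrow> i < n \<longrightarrow> Vector_Spaces.linear s s (\<lambda>x. b (xs[i := x])))"

text \<open>In the fundamental identity, ys is the list of the n - 1 variables y_2, ..., y_n.\<close>

definition leibniz_algebra :: "nat \<Rightarrow> ('k::field \<Rightarrow> 'a::ab_group_add \<Rightarrow> 'a) \<Rightarrow> ('a list \<Rightarrow> 'a) \<Rightarrow> bool" where
  "leibniz_algebra n s b \<longleftrightarrow>
     vector_space s \<and> multilinear n s b \<and>
     (\<forall>xs ys. length xs = n \<longrightarrow> Suc (length ys) = n \<longrightarrow>
        b (b xs # ys) = (\<Sum>i<n. b (xs[i := b (xs ! i # ys)])))"

text \<open>
  The k-fold right-nested bracket on lists of length k (n - 1) + 1. For the algebra bracket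
  and k at least 1 it is the bracket of \<open>U\<^sub>n\<^sup>p\<close>; the value at k = 0 (arity 1) is the identity.
\<close>

fun nested_bracket :: "nat \<Rightarrow> nat \<Rightarrow> ('a list \<Rightarrow> 'a) \<Rightarrow> 'a list \<Rightarrow> 'a" where
  "nested_bracket n 0 b xs = hd xs"
| "nested_bracket n (Suc k) b xs =
     b (take (n - 1) xs @ [nested_bracket n k b (drop (n - 1) xs)])"

text \<open>
  For an action of P (type 'p) on L (type 'l), an argument list mixing the two algebras is a list
  over \<open>'l + 'p\<close>. The pattern of \<open>Inl\<close> and \<open>Inr\<close> is the choice of \<open>A\<^sub>1, \<dots>, A\<^sub>n\<close>, so a
  single function on such lists encodes the whole family of mixed brackets; its values on
  non-mixed lists are irrelevant.
\<close>

definition mixed :: "('l + 'p) list \<Rightarrow> bool" where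
  "mixed xs \<longleftrightarrow> (\<exists>x\<in>set xs. isl x) \<and> (\<exists>x\<in>set xs. \<not> isl x)"

definition mixed_multilinear ::
  "nat \<Rightarrow> ('k::field \<Rightarrow> 'p::ab_group_add \<Rightarrow> 'p) \<Rightarrow> ('k \<Rightarrow> 'l::ab_group_add \<Rightarrow> 'l)
    \<Rightarrow> (('l + 'p) list \<Rightarrow> 'l) \<Rightarrow> bool" where
  "mixed_multilinear n sP sL act \<longleftrightarrow>
     (\<forall>xs i. length xs = n \<longrightarrow> i < n \<longrightarrow> mixed xs \<longrightarrow>
        (isl (xs ! i) \<longrightarrow> Vector_Spaces.linear sL sL (\<lambda>x. act (xs[i := Inl x]))) \<and>
        (\<not> isl (xs ! i) \<longrightarrow> Vector_Spaces.linear sP sL (\<lambda>x. act (xs[i := Inr x]))))"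

definition total_bracket ::
  "('p list \<Rightarrow> 'p) \<Rightarrow> ('l list \<Rightarrow> 'l) \<Rightarrow> (('l + 'p) list \<Rightarrow> 'l) \<Rightarrow> ('l + 'p) list \<Rightarrow> 'l + 'p" where
  "total_bracket bP bL act xs =
     (if \<forall>x\<in>set xs. isl x then Inl (bL (map projl xs))
      else if \<forall>x\<in>set xs. \<not> isl x then Inr (bP (map projr xs))
      else Inl (act xs))"

lemma isl_total_bracket_iff:
  "xs \<noteq> [] \<Longrightarrow> isl (total_bracket bP bL act xs) \<longleftrightarrow> (\<exists>x\<in>set xs. isl x)"
  by (cases xs) (auto simp: total_bracket_def)

text \<open>
  Some variable of the identity lies in L, so both sides lie in L by
  \<open>isl_total_bracket_iff\<close>; hence the use of \<open>projl\<close>.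
\<close>

definition leibniz_action ::
  "nat \<Rightarrow> ('k::field \<Rightarrow> 'p::ab_group_add \<Rightarrow> 'p) \<Rightarrow> ('p list \<Rightarrow> 'p)
    \<Rightarrow> ('k \<Rightarrow> 'l::ab_group_add \<Rightarrow> 'l) \<Rightarrow> ('l list \<Rightarrow> 'l) \<Rightarrow> (('l + 'p) list \<Rightarrow> 'l) \<Rightarrow> bool" where
  "leibniz_action n sP bP sL bL act \<longleftrightarrow>
     leibniz_algebra n sP bP \<and> leibniz_algebra n sL bL \<and>
     mixed_multilinear n sP sL act \<and>
     (let B = total_bracket bP bL act in
       \<forall>xs ys. length xs = n \<longrightarrow> Suc (length ys) = n \<longrightarrow> mixed (xs @ ys) \<longrightarrow>
         projl (B (B xs # ys)) = (\<Sum>i<n. projl (B (xs[i := B (xs ! i # ys)]))))"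

text \<open>
  The mixed brackets of arity k (n - 1) + 1 are given by the same nested formula, each of the k
  brackets being the one of P, the one of L or a mixed one, according to its entries.
  (The bare existence of an action would be trivial: all mixed brackets may be zero.)
\<close>

definition nested_action ::
  "nat \<Rightarrow> nat \<Rightarrow> ('p list \<Rightarrow> 'p) \<Rightarrow> ('l list \<Rightarrow> 'l) \<Rightarrow> (('l + 'p) list \<Rightarrow> 'l) \<Rightarrow> ('l + 'p) list \<Rightarrow> 'l" where
  "nested_action n k bP bL act xs = projl (nested_bracket n k (total_bracket bP bL act) xs)"

end

theory Submission
  imports Defs "HOL-Library.Product_Plus"
begin

text \<open>
  Right multiplication by n - 1 fixed elements is a derivation of the n-ary bracket, hence, by
  induction on the nesting depth, of every nested bracket. Right multiplication in the
  k-fold nested bracket is such a multiplication in the n-ary bracket: its last factor is a nested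
  bracket of depth k - 1. This gives the fundamental identity in arity p.

  To cover algebras and actions alike, the operation acts on homogeneous elements
  embedded in a vector space. A single algebra is the case of one degree; an action of P on
  L is the case of the homogeneous elements of the semidirect product of L and P.
\<close>

section \<open>Brackets on homogeneous elements\<close>

text \<open>Isolates position \<open>i\<close>, so that degrees of lists differing in one entry can
  be compared. With \<open>v\<close> equal to \<open>xs ! i\<close> it describes \<open>xs\<close>
  itself.\<close>

lemma bex_set_update:
  assumes "i < length xs"
  shows "(\<exists>x\<in>set (xs[i := v]). g x) \<longleftrightarrow> g v \<or> (\<exists>j<length xs. j \<noteq> i \<and> g (xs ! j))"
proof -
  have "(\<exists>x\<in>set (xs[i := v]). g x) \<longleftrightarrow> (\<exists>j<length xs. g (xs[i := v] ! j))"
    by (metis in_set_conv_nth length_list_update)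
  then show ?thesis using assms by (auto simp: nth_list_update)
qed

text \<open>
  \<open>e\<close> sends a homogeneous element to its vector and \<open>g\<close> is its degree. Only linear combinations of
  elements of equal degree are meaningful, and multilinearity is stated for these.
\<close>

locale graded_leibniz =
  fixes n :: nat
    and s :: "'k::field \<Rightarrow> 'v::ab_group_add \<Rightarrow> 'v"
    and g :: "'a \<Rightarrow> bool"
    and e :: "'a \<Rightarrow> 'v"
    and B :: "'a list \<Rightarrow> 'a"
  assumes vs: "vector_space s"
    and arity: "n \<ge> 2"
    and grade: "length xs = n \<Longrightarrow> g (B xs) \<longleftrightarrow> (\<exists>x\<in>set xs. g x)"
    and combination:
      "\<lbrakk>length xs = n; i < n; finite (J :: nat set); \<And>j. j \<in> J \<Longrightarrow> g (w j) = g z;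
        e z = (\<Sum>j\<in>J. s (c j) (e (w j)))\<rbrakk>
       \<Longrightarrow> e (B (xs[i := z])) = (\<Sum>j\<in>J. s (c j) (e (B (xs[i := w j]))))"
    and fundamental:
      "\<lbrakk>length xs = n; Suc (length ys) = n\<rbrakk>
       \<Longrightarrow> e (B (B xs # ys)) = (\<Sum>i<n. e (B (xs[i := B (xs ! i # ys)])))"
begin

section \<open>Degree, linearity and derivations of nested brackets\<close>

lemma grade_nested:
  "length xs = k * (n - 1) + 1 \<Longrightarrow> g (nested_bracket n k B xs) \<longleftrightarrow> (\<exists>x\<in>set xs. g x)"
proof (induction k arbitrary: xs)
  case 0
  then show ?case by (cases xs) auto
next
  case (Suc k)
  have len: "length (take (n - 1) xs @ [nested_bracket n k B (drop (n - 1) xs)]) = n"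
    using Suc.prems arity by simp
  have "set xs = set (take (n - 1) xs) \<union> set (drop (n - 1) xs)"
    by (metis append_take_drop_id set_append)
  moreover have "g (nested_bracket n k B (drop (n - 1) xs)) \<longleftrightarrow> (\<exists>x\<in>set (drop (n - 1) xs). g x)"
    using Suc.prems by (intro Suc.IH) simp
  ultimately show ?case using grade[OF len] by auto
qed

text \<open>A slot among the first n - 1 belongs to the outer bracket; any other slot lies in the
  inner bracket, whose linearity passes through the last outer slot. The type \<open>'a\<close>
  carries no addition, so finite sums are handled at once rather than through partial sums, which
  would need representatives in \<open>'a\<close>.\<close>

lemma combination_nested:
  fixes J :: "nat set"
  assumes "length xs = k * (n - 1) + 1" "i < k * (n - 1) + 1" "finite J"
    and "\<And>j. j \<in> J \<Longrightarrow> g (w j) = g z" and "e z = (\<Sum>j\<in>J. s (c j) (e (w j)))"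
  shows "e (nested_bracket n k B (xs[i := z])) =
    (\<Sum>j\<in>J. s (c j) (e (nested_bracket n k B (xs[i := w j]))))"
  using assms(1,2)
proof (induction k arbitrary: xs i)
  case 0
  then show ?case using assms(5) by (cases xs) auto
next
  case (Suc k)
  let ?N = "nested_bracket n k B"
  define us where "us = take (n - 1) xs @ [?N (drop (n - 1) xs)]"
  have len: "length us = n" using Suc.prems arity by (simp add: us_def)
  show ?case
  proof (cases "i < n - 1")
    case True
    have "nested_bracket n (Suc k) B (xs[i := x]) = B (us[i := x])" for x
      using True Suc.prems(1) by (simp add: us_def take_update_swap list_update_append)
    then show ?thesis
      using combination[OF len, of i J w z c] True assms by simp
  next
    case False
    define d where "d = drop (n - 1) xs"
    have ld: "length d = k * (n - 1) + 1" using Suc.prems by (simp add: d_def)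
    have id: "i - (n - 1) < k * (n - 1) + 1" using Suc.prems False by simp
    have upd: "nested_bracket n (Suc k) B (xs[i := x]) =
        B (us[n - 1 := ?N (d[i - (n - 1) := x])])" for x
      using False Suc.prems(1) by (simp add: us_def d_def drop_update_swap list_update_append)
    \<comment> \<open>The outer bracket is linear only in elements of one degree; the inner brackets
      share theirs because it depends only on the degrees of their entries.\<close>
    have "g (?N (d[i - (n - 1) := w j])) = g (?N (d[i - (n - 1) := z]))" if "j \<in> J" for j
      using assms(4)[OF that] ld id by (simp add: grade_nested bex_set_update)
    then show ?thesis unfolding upd
      using Suc.IH[OF ld id] arity assms(3) by (intro combination[OF len]) auto
  qed
qed

lemma sum_split_lessThan_add:
  fixes f :: "nat \<Rightarrow> 'b::comm_monoid_add"
  shows "(\<Sum>i<a + b. f i) = (\<Sum>i<a. f i) + (\<Sum>j<b. f (a + j))"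
  by (induction b) (simp_all add: add.assoc)

text \<open>The fundamental identity of the outer bracket gives n terms. In the last one the
  multiplication falls on the inner bracket, and the induction hypothesis with linearity in that
  slot spreads it over the remaining entries.\<close>

lemma derivation_nested:
  assumes "length xs = k * (n - 1) + 1" and ys: "Suc (length ys) = n"
  shows "e (B (nested_bracket n k B xs # ys)) =
    (\<Sum>i<k * (n - 1) + 1. e (nested_bracket n k B (xs[i := B (xs ! i # ys)])))"
  using assms(1)
proof (induction k arbitrary: xs)
  case 0
  then show ?case by (cases xs) auto
next
  case (Suc k)
  let ?N = "nested_bracket n k B" and ?m = "k * (n - 1) + 1"
  define d where "d = drop (n - 1) xs"
  define us where "us = take (n - 1) xs @ [?N d]"
  have lu: "length us = n" using Suc.prems arity by (simp add: us_def)
  have ld: "length d = ?m" using Suc.prems by (simp add: d_def)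
  have last: "us ! (n - 1) = ?N d" using Suc.prems by (simp add: us_def nth_append)
  have front: "B (us[i := B (us ! i # ys)]) =
      nested_bracket n (Suc k) B (xs[i := B (xs ! i # ys)])" if "i < n - 1" for i
    using that Suc.prems
    by (simp add: us_def d_def take_update_swap list_update_append nth_append)
  have rear: "B (us[n - 1 := ?N (d[j := B (d ! j # ys)])]) =
      nested_bracket n (Suc k) B (xs[n - 1 + j := B (xs ! (n - 1 + j) # ys)])" if "j < ?m" for j
    using that Suc.prems by (simp add: us_def d_def drop_update_swap list_update_append)
  \<comment> \<open>Both degrees record whether \<open>g\<close> holds somewhere in \<open>d\<close>
    or \<open>ys\<close>, so the inner terms may be combined.\<close>
  have "g (?N (d[j := B (d ! j # ys)])) \<longleftrightarrow> g (B (?N d # ys))" if "j < ?m" for j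
  proof -
    have "(\<exists>x\<in>set (d[j := B (d ! j # ys)]). g x) \<longleftrightarrow> (\<exists>x\<in>set d. g x) \<or> (\<exists>y\<in>set ys. g y)"
    proof -
      have j: "j < length d" using that ld by simp
      show ?thesis
        using bex_set_update[OF j, where g = g and v = "d ! j"] grade[of "d ! j # ys"] ys
        by (auto simp: bex_set_update[OF j])
    qed
    then show ?thesis using grade[of "?N d # ys"] ys ld by (simp add: grade_nested)
  qed
  \<comment> \<open>The induction hypothesis, read as a linear combination with all coefficients
    \<open>1\<close>.\<close>
  then have "e (B (us[n - 1 := B (?N d # ys)])) =
      (\<Sum>j<?m. s 1 (e (B (us[n - 1 := ?N (d[j := B (d ! j # ys)])]))))"
    using Suc.IH[OF ld] arity vector_space.vector_space_assms(4)[OF vs]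
    by (intro combination[OF lu]) auto
  then have last_sum: "e (B (us[n - 1 := B (?N d # ys)])) =
      (\<Sum>j<?m. e (nested_bracket n (Suc k) B (xs[n - 1 + j := B (xs ! (n - 1 + j) # ys)])))"
    by (rule trans, intro sum.cong)
      (use rear in \<open>simp_all add: vector_space.vector_space_assms(4)[OF vs] del: nested_bracket.simps\<close>)
  have "e (B (nested_bracket n (Suc k) B xs # ys)) = e (B (B us # ys))"
    by (simp add: us_def d_def)
  also have "\<dots> = (\<Sum>i<Suc (n - 1). e (B (us[i := B (us ! i # ys)])))"
    using fundamental[OF lu ys] arity by simp
  also have "\<dots> = (\<Sum>i<n - 1. e (nested_bracket n (Suc k) B (xs[i := B (xs ! i # ys)])))
      + (\<Sum>j<?m. e (nested_bracket n (Suc k) B (xs[n - 1 + j := B (xs ! (n - 1 + j) # ys)])))"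
    unfolding sum.lessThan_Suc last last_sum using front
    by (intro arg_cong2[of _ _ _ _ "(+)"] sum.cong) simp_all
  also have "\<dots> = (\<Sum>i<n - 1 + ?m. e (nested_bracket n (Suc k) B (xs[i := B (xs ! i # ys)])))"
    by (rule sum_split_lessThan_add[symmetric])
  finally show ?case by (simp add: add.assoc del: nested_bracket.simps)
qed

text \<open>As n is at least 2, \<open>x\<close> stays in the outermost bracket, and the inner one
  consumes entries of \<open>ys\<close> only.\<close>

lemma right_multiplication_nested:
  "nested_bracket n (Suc k) B (x # ys) =
    B (x # take (n - 2) ys @ [nested_bracket n k B (drop (n - 2) ys)])"
proof -
  obtain m where "n = Suc (Suc m)"
    using arity by (metis add_2_eq_Suc le_Suc_ex)
  then show ?thesis by simp
qed

lemma fundamental_nested: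
  assumes "k \<ge> 1" "length xs = k * (n - 1) + 1" "length ys = k * (n - 1)"
  shows "e (nested_bracket n k B (nested_bracket n k B xs # ys)) =
    (\<Sum>i<k * (n - 1) + 1.
      e (nested_bracket n k B (xs[i := nested_bracket n k B (xs ! i # ys)])))"
proof -
  obtain k' where k: "k = Suc k'" using assms(1) by (cases k) auto
  \<comment> \<open>These n - 1 right factors do not involve the first argument, so the same
    \<open>zs\<close> serves the left side and every summand.\<close>
  define zs where "zs = take (n - 2) ys @ [nested_bracket n k' B (drop (n - 2) ys)]"
  have "length ys \<ge> n - 2" using assms(3) k by simp
  then have "Suc (length zs) = n" using arity by (simp add: zs_def)
  moreover have "nested_bracket n k B (x # ys) = B (x # zs)" for x
    unfolding k zs_def by (rule right_multiplication_nested)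
  ultimately show ?thesis using derivation_nested[OF assms(2)] by simp
qed

lemma graded_leibniz_nested:
  assumes "k \<ge> 1"
  shows "graded_leibniz (k * (n - 1) + 1) s g e (nested_bracket n k B)"
proof (rule graded_leibniz.intro)
  show "2 \<le> k * (n - 1) + 1" using assms arity by (cases k) auto
qed (use vs assms grade_nested combination_nested fundamental_nested in simp_all)

end

text \<open>The axioms evaluate the operation on lists of length \<open>n\<close> only. Needed
  because \<open>nested_action\<close> describes the nested total bracket only on lists of the right
  length.\<close>

lemma graded_leibniz_cong:
  assumes "graded_leibniz n s g e B" and "\<And>xs. length xs = n \<Longrightarrow> B' xs = B xs"
  shows "graded_leibniz n s g e B'"
proof -
  interpret graded_leibniz n s g e B by fact
  show ?thesis
    unfolding graded_leibniz_def
    using vs arity grade combination fundamental by (simp add: assms(2))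
qed

section \<open>Linear maps and single algebras\<close>

lemma linear_combination:
  assumes "Vector_Spaces.linear s1 s2 f"
  shows "f (\<Sum>j\<in>J. s1 (c j) (w j)) = (\<Sum>j\<in>J. s2 (c j) (f (w j)))"
proof -
  interpret Vector_Spaces.linear s1 s2 f by fact
  show ?thesis by (simp add: sum scale)
qed

lemma linear_if_combination:
  fixes f :: "'a::ab_group_add \<Rightarrow> 'b::ab_group_add"
  assumes "vector_space s1" "vector_space s2"
    and comb: "\<And>(J :: nat set) c w. finite J \<Longrightarrow>
      f (\<Sum>j\<in>J. s1 (c j) (w j)) = (\<Sum>j\<in>J. s2 (c j) (f (w j)))"
  shows "Vector_Spaces.linear s1 s2 f"
proof -
  have "f (x + y) = f x + f y" for x y
    \<comment> \<open>Two indices with coefficients \<open>1\<close> give additivity; a single index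
      gives homogeneity.\<close>
    using comb[of "{0, 1}" "\<lambda>_. 1" "\<lambda>j. if j = 0 then x else y"] assms(1,2)
    by (simp add: vector_space.vector_space_assms(4))
  moreover have "f (s1 a x) = s2 a (f x)" for a x
    using comb[of "{0}" "\<lambda>_. a" "\<lambda>_. x"] by simp
  ultimately show ?thesis
    using assms(1,2) by (simp add: Vector_Spaces.linear_iff)
qed

lemma leibniz_algebra_iff_graded:
  assumes "n \<ge> 2"
  shows "leibniz_algebra n s b \<longleftrightarrow> graded_leibniz n s (\<lambda>_. True) id b"
proof
  assume alg: "leibniz_algebra n s b"
  show "graded_leibniz n s (\<lambda>_. True) id b"
  proof (rule graded_leibniz.intro)
    show "vector_space s" using alg by (simp add: leibniz_algebra_def)
    \<comment> \<open>With constant degree this axiom says only that the list is nonempty.\<close>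
    show "True \<longleftrightarrow> (\<exists>x\<in>set xs. True)" if "length xs = n" for xs :: "'b list"
      using that assms by (cases xs) auto
    show "id (b (xs[i := z])) = (\<Sum>j\<in>J. s (c j) (id (b (xs[i := w j]))))"
      if "length xs = n" "i < n" "id z = (\<Sum>j\<in>J. s (c j) (id (w j)))"
      for xs i J w z c
      using linear_combination[of s s "\<lambda>x. b (xs[i := x])"] alg that
      by (simp add: leibniz_algebra_def multilinear_def)
  qed (use alg assms in \<open>simp_all add: leibniz_algebra_def\<close>)
next
  assume "graded_leibniz n s (\<lambda>_. True) id b"
  then interpret graded_leibniz n s "\<lambda>_. True" id b .
  have "Vector_Spaces.linear s s (\<lambda>x. b (xs[i := x]))" if "length xs = n" "i < n" for xs i
    using combination[OF that] vs by (intro linear_if_combination) simp_all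
  then show "leibniz_algebra n s b"
    using vs fundamental by (simp add: leibniz_algebra_def multilinear_def)
qed

section \<open>Actions\<close>

text \<open>Homogeneous elements of the semidirect product; the zeros of L and P have the same image.\<close>

definition embed :: "'l::zero + 'p::zero \<Rightarrow> 'l \<times> 'p" where
  "embed = case_sum (\<lambda>l. (l, 0)) (\<lambda>q. (0, q))"

definition pair_scale :: "('k \<Rightarrow> 'l \<Rightarrow> 'l) \<Rightarrow> ('k \<Rightarrow> 'p \<Rightarrow> 'p) \<Rightarrow> 'k \<Rightarrow> 'l \<times> 'p \<Rightarrow> 'l \<times> 'p" where
  "pair_scale sL sP c = map_prod (sL c) (sP c)"

lemma embed_simps [simp]: "embed (Inl l) = (l, 0)" "embed (Inr q) = (0, q)"
  by (simp_all add: embed_def)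

lemma embed_isl: "isl z \<Longrightarrow> embed z = (projl z, 0)"
  by (cases z) simp_all

lemma pair_scale_simps [simp]:
  "fst (pair_scale sL sP c v) = sL c (fst v)" "snd (pair_scale sL sP c v) = sP c (snd v)"
  by (simp_all add: pair_scale_def)

lemma vector_space_pair_scale:
  "vector_space sL \<Longrightarrow> vector_space sP \<Longrightarrow> vector_space (pair_scale sL sP)"
  by (simp add: vector_space_def prod_eq_iff)

section \<open>Patterns of entries and the semidirect product\<close>

lemma mixed_cong:
  assumes "map isl xs = map isl ys"
  shows "mixed xs \<longleftrightarrow> mixed ys"
proof -
  have "mixed us \<longleftrightarrow> True \<in> set (map isl us) \<and> False \<in> set (map isl us)" for us :: "('x + 'y) list"
    by (force simp: mixed_def)
  then show ?thesis using assms by metis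
qed

lemma total_bracket_Inl: "total_bracket bP bL act (map Inl xs) = Inl (bL xs)"
  by (simp add: total_bracket_def comp_def)

lemma total_bracket_Inr: "xs \<noteq> [] \<Longrightarrow> total_bracket bP bL act (map Inr xs) = Inr (bP xs)"
  by (cases xs) (simp_all add: total_bracket_def comp_def)

lemma total_bracket_mixed: "mixed xs \<Longrightarrow> total_bracket bP bL act xs = Inl (act xs)"
  by (auto simp: total_bracket_def mixed_def)

text \<open>Follows the three branches of \<open>total_bracket\<close>; pure lists appear as images,
  so that the laws of the two algebras apply directly.\<close>

lemma homogeneous_cases:
  obtains (L) ls where "xs = map Inl ls" | (P) qs where "xs = map Inr qs" | (mixed) "mixed xs"
proof (cases "mixed xs")
  case False
  then consider "\<forall>x\<in>set xs. isl x" | "\<forall>x\<in>set xs. \<not> isl x" by (auto simp: mixed_def)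
  then show ?thesis
  proof cases
    case 1
    then have "xs = map Inl (map projl xs)" by (simp add: map_idI)
    then show ?thesis by (rule L)
  next
    case 2
    then have "xs = map Inr (map projr xs)" by (simp add: map_idI)
    then show ?thesis by (rule P)
  qed
qed (rule mixed)

text \<open>The new entry lies in L iff \<open>xs ! i\<close> or an entry of \<open>ys\<close> does.
  Hence \<open>projl\<close> loses nothing on the summands of a mixed fundamental identity.\<close>

lemma isl_total_bracket_update:
  assumes "length xs = n" "i < n"
  shows "isl (total_bracket bP bL act (xs[i := total_bracket bP bL act (xs ! i # ys)])) \<longleftrightarrow>
    (\<exists>x\<in>set (xs @ ys). isl x)"
proof -
  have i: "i < length xs" using assms by simp
  have "xs[i := v] \<noteq> []" for v using i by auto
  then show ?thesis
    using bex_set_update[OF i, where g = isl and v = "xs ! i"]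
    by (auto simp: isl_total_bracket_iff bex_set_update[OF i])
qed

text \<open>Replacing an entry by one of the same kind keeps the pattern, so \<open>z\<close> and
  all \<open>w j\<close> fall under the same branch of the total bracket, which is linear in that
  slot.\<close>

lemma embed_total_bracket_combination:
  fixes J :: "nat set"
  assumes algP: "leibniz_algebra n sP bP" and algL: "leibniz_algebra n sL bL"
    and multi: "mixed_multilinear n sP sL act"
    and len: "length xs = n" "i < n"
    and w: "\<And>j. j \<in> J \<Longrightarrow> isl (w j) = isl z"
    and z: "embed z = (\<Sum>j\<in>J. pair_scale sL sP (c j) (embed (w j)))"
  shows "embed (total_bracket bP bL act (xs[i := z])) =
    (\<Sum>j\<in>J. pair_scale sL sP (c j) (embed (total_bracket bP bL act (xs[i := w j]))))"
proof -
  let ?B = "total_bracket bP bL act" and ?s = "pair_scale sL sP"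
  interpret L: vector_space sL using algL by (simp add: leibniz_algebra_def)
  interpret P: vector_space sP using algP by (simp add: leibniz_algebra_def)
  have linL: "Vector_Spaces.linear sL sL (\<lambda>x. bL (ls[i := x]))" if "length ls = n" for ls
    using that algL len by (simp add: leibniz_algebra_def multilinear_def)
  have linP: "Vector_Spaces.linear sP sP (\<lambda>x. bP (ls[i := x]))" if "length ls = n" for ls
    using that algP len by (simp add: leibniz_algebra_def multilinear_def)
  have mixed_iff: "mixed (xs[i := x]) \<longleftrightarrow> mixed (xs[i := y])" if "isl x = isl y" for x y
    using that by (intro mixed_cong) (simp add: map_update)
  show ?thesis
  proof (cases z)
    case (Inl l)
    define v where "v j = projl (w j)" for j
    have wv: "w j = Inl (v j)" if "j \<in> J" for j using w[OF that] Inl by (simp add: v_def)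
    have l: "l = (\<Sum>j\<in>J. sL (c j) (v j))"
      using arg_cong[OF z, of fst] Inl by (simp add: fst_sum wv)
    \<comment> \<open>An entry from L forces the value into L, so one map \<open>f\<close> covers
      both \<open>bL\<close> and \<open>act\<close>.\<close>
    have "\<exists>f. Vector_Spaces.linear sL sL f \<and> (\<forall>x. ?B (xs[i := Inl x]) = Inl (f x))"
    proof (cases rule: homogeneous_cases[of "xs[i := Inl l]"])
      case (L ls)
      have "xs[i := Inl x] = map Inl (ls[i := x])" for x
        using arg_cong[OF L, of "\<lambda>us. us[i := Inl x]"] by (simp add: map_update)
      moreover have "length ls = n" using arg_cong[OF L, of length] len by simp
      ultimately show ?thesis using linL by (auto simp: total_bracket_Inl)
    next
      case (P qs)
      then show ?thesis using set_update_memI[of i xs "Inl l"] len unfolding P by auto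
    next
      case mixed
      then have "Vector_Spaces.linear sL sL (\<lambda>x. act (xs[i := Inl l, i := Inl x]))"
        using multi[unfolded mixed_multilinear_def, rule_format, of "xs[i := Inl l]" i] len by simp
      moreover have "mixed (xs[i := Inl x])" for x using mixed mixed_iff by (metis sum.disc(1))
      ultimately show ?thesis by (auto simp: total_bracket_mixed)
    qed
    then obtain f where "Vector_Spaces.linear sL sL f" "\<And>x. ?B (xs[i := Inl x]) = Inl (f x)" by blast
    then show ?thesis
      using linear_combination[of sL sL f c v J] Inl l
      by (simp add: wv prod_eq_iff fst_sum snd_sum)
  next
    case (Inr q)
    define v where "v j = projr (w j)" for j
    have wv: "w j = Inr (v j)" if "j \<in> J" for j using w[OF that] Inr by (simp add: v_def)
    have q: "q = (\<Sum>j\<in>J. sP (c j) (v j))"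
      using arg_cong[OF z, of snd] Inr by (simp add: snd_sum wv)
    \<comment> \<open>Here the value lies in P for a pure list and in L for a mixed one, so the
      target of the linear map depends on the case.\<close>
    show ?thesis
    proof (cases rule: homogeneous_cases[of "xs[i := Inr q]"])
      case (L ls)
      then show ?thesis using set_update_memI[of i xs "Inr q"] len unfolding L by auto
    next
      case (P qs)
      have "xs[i := Inr x] = map Inr (qs[i := x])" for x
        using arg_cong[OF P, of "\<lambda>us. us[i := Inr x]"] by (simp add: map_update)
      moreover have lq: "length qs = n" using arg_cong[OF P, of length] len by simp
      ultimately have "?B (xs[i := Inr x]) = Inr (bP (qs[i := x]))" for x
        using len by (subst \<open>\<And>x. xs[i := Inr x] = _\<close>, subst total_bracket_Inr) auto
      then show ?thesis
        using linear_combination[OF linP[OF lq], of c v J] Inr q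
        by (simp add: wv prod_eq_iff fst_sum snd_sum)
    next
      case mixed
      then have "Vector_Spaces.linear sP sL (\<lambda>x. act (xs[i := Inr q, i := Inr x]))"
        using multi[unfolded mixed_multilinear_def, rule_format, of "xs[i := Inr q]" i] len by simp
      then have lin: "Vector_Spaces.linear sP sL (\<lambda>x. act (xs[i := Inr x]))" by simp
      have "mixed (xs[i := Inr x])" for x using mixed mixed_iff by (metis sum.disc(2))
      then show ?thesis
        using linear_combination[OF lin, of c v J] Inr q
        by (simp add: wv prod_eq_iff fst_sum snd_sum total_bracket_mixed)
    qed
  qed
qed

text \<open>The pattern of \<open>xs @ ys\<close> selects the identity of L, of P or of the action;
  together they form the single fundamental identity of the semidirect product.\<close>

lemma embed_total_bracket_fundamental:
  assumes act: "leibniz_action n sP bP sL bL act"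
    and len: "length xs = n" "Suc (length ys) = n"
  defines "B \<equiv> total_bracket bP bL act"
  shows "embed (B (B xs # ys)) = (\<Sum>i<n. embed (B (xs[i := B (xs ! i # ys)])))"
proof (cases rule: homogeneous_cases[of "xs @ ys"])
  case (L us)
  then obtain ls ms where "xs = map Inl ls" "ys = map Inl ms" by (auto simp: append_eq_map_conv)
  moreover have "B (Inl l # map Inl ms) = Inl (bL (l # ms))" for l
    unfolding B_def using total_bracket_Inl[of bP bL act "l # ms"] by simp
  moreover have "B (map Inl ls) = Inl (bL ls)" for ls
    unfolding B_def by (rule total_bracket_Inl)
  ultimately show ?thesis
    using act len
    by (simp add: leibniz_action_def leibniz_algebra_def prod_eq_iff fst_sum snd_sum
        flip: map_update)
next
  case (P us)
  then obtain ls ms where "xs = map Inr ls" "ys = map Inr ms" by (auto simp: append_eq_map_conv)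
  moreover have "B (Inr l # map Inr ms) = Inr (bP (l # ms))" for l
    unfolding B_def using total_bracket_Inr[of "l # ms" bP bL act] by simp
  moreover have "B (map Inr ls) = Inr (bP ls)" if "length ls = n" for ls
    unfolding B_def using that len by (intro total_bracket_Inr) auto
  ultimately show ?thesis
    using act len
    by (simp add: leibniz_action_def leibniz_algebra_def prod_eq_iff fst_sum snd_sum
        flip: map_update)
next
  case mixed
  then have ex: "\<exists>x\<in>set (xs @ ys). isl x" by (auto simp: mixed_def)
  have "xs \<noteq> []" using len by auto
  \<comment> \<open>All terms lie in L: their second coordinates vanish and the action identity
    gives the first.\<close>
  then have "isl (B (B xs # ys))"
    using ex by (auto simp: B_def isl_total_bracket_iff)
  moreover have "isl (B (xs[i := B (xs ! i # ys)]))" if "i < n" for i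
    unfolding B_def using isl_total_bracket_update[OF len(1) that] ex by blast
  moreover have "projl (B (B xs # ys)) = (\<Sum>i<n. projl (B (xs[i := B (xs ! i # ys)])))"
    using act mixed len by (simp add: leibniz_action_def B_def Let_def)
  ultimately show ?thesis by (simp add: embed_isl prod_eq_iff fst_sum snd_sum)
qed

lemma graded_leibniz_total_bracket:
  assumes n: "n \<ge> 2" and act: "leibniz_action n sP bP sL bL act"
  shows "graded_leibniz n (pair_scale sL sP) isl embed (total_bracket bP bL act)"
proof (rule graded_leibniz.intro)
  show "vector_space (pair_scale sL sP)"
    using act by (simp add: leibniz_action_def leibniz_algebra_def vector_space_pair_scale)
  show "isl (total_bracket bP bL act xs) \<longleftrightarrow> (\<exists>x\<in>set xs. isl x)" if "length xs = n" for xs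
    using that n by (intro isl_total_bracket_iff) auto
qed (use act n embed_total_bracket_fundamental[OF act] in
    \<open>auto simp only: leibniz_action_def intro!: embed_total_bracket_combination\<close>)

text \<open>On mixed lists \<open>act\<close> is the first coordinate of the embedded total bracket,
  so multilinearity and the mixed identities can be read off from the semidirect product.\<close>

lemma leibniz_action_if_graded:
  assumes algP: "leibniz_algebra n sP bP" and algL: "leibniz_algebra n sL bL"
    and graded: "graded_leibniz n (pair_scale sL sP) isl embed (total_bracket bP bL act)"
  shows "leibniz_action n sP bP sL bL act"
proof -
  let ?B = "total_bracket bP bL act"
  interpret graded_leibniz n "pair_scale sL sP" isl embed ?B by fact
  interpret L: vector_space sL using algL by (simp add: leibniz_algebra_def)
  interpret P: vector_space sP using algP by (simp add: leibniz_algebra_def)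
  have embed_mixed: "act us = fst (embed (?B us))" if "mixed us" for us
    using that by (simp add: total_bracket_mixed)
  have "mixed_multilinear n sP sL act"
    unfolding mixed_multilinear_def
  proof (intro allI impI conjI)
    fix xs :: "('c + 'b) list" and i
    assume len: "length xs = n" "i < n" and mixed: "mixed xs"
    \<comment> \<open>Keeps every term of a linear combination mixed, so that
      \<open>embed_mixed\<close> applies to each.\<close>
    have mixed_update: "mixed (xs[i := x])" if "isl x = isl (xs ! i)" for x
      using mixed_cong[of "xs[i := x]" xs] mixed that len
      by (simp add: map_update list_update_same_conv)
    show "Vector_Spaces.linear sL sL (\<lambda>x. act (xs[i := Inl x]))" if "isl (xs ! i)"
    proof (rule linear_if_combination)
      fix J :: "nat set" and c w
      assume "finite J"
      then have "embed (?B (xs[i := Inl (\<Sum>j\<in>J. sL (c j) (w j))])) =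
          (\<Sum>j\<in>J. pair_scale sL sP (c j) (embed (?B (xs[i := Inl (w j)]))))"
        by (intro combination len) (simp_all add: prod_eq_iff fst_sum snd_sum)
      then show "act (xs[i := Inl (\<Sum>j\<in>J. sL (c j) (w j))]) =
          (\<Sum>j\<in>J. sL (c j) (act (xs[i := Inl (w j)])))"
        using that by (simp add: embed_mixed mixed_update fst_sum)
    qed (rule L.vector_space_axioms)+
    show "Vector_Spaces.linear sP sL (\<lambda>x. act (xs[i := Inr x]))" if "\<not> isl (xs ! i)"
    proof (rule linear_if_combination)
      fix J :: "nat set" and c w
      assume "finite J"
      then have "embed (?B (xs[i := Inr (\<Sum>j\<in>J. sP (c j) (w j))])) =
          (\<Sum>j\<in>J. pair_scale sL sP (c j) (embed (?B (xs[i := Inr (w j)]))))"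
        by (intro combination len) (simp_all add: prod_eq_iff fst_sum snd_sum)
      then show "act (xs[i := Inr (\<Sum>j\<in>J. sP (c j) (w j))]) =
          (\<Sum>j\<in>J. sL (c j) (act (xs[i := Inr (w j)])))"
        using that by (simp add: embed_mixed mixed_update fst_sum)
    qed (rule P.vector_space_axioms L.vector_space_axioms)+
  qed
  moreover have "projl (?B (?B xs # ys)) = (\<Sum>i<n. projl (?B (xs[i := ?B (xs ! i # ys)])))"
    if len: "length xs = n" "Suc (length ys) = n" and mixed: "mixed (xs @ ys)" for xs ys
  proof -
    have ex: "\<exists>x\<in>set (xs @ ys). isl x" using mixed by (auto simp: mixed_def)
    have "xs \<noteq> []" using len by auto
    then have "isl (?B (?B xs # ys))"
      using ex by (auto simp: isl_total_bracket_iff)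
    moreover have "isl (?B (xs[i := ?B (xs ! i # ys)]))" if "i < n" for i
      using isl_total_bracket_update[OF len(1) that] ex by blast
    ultimately show ?thesis
      using fundamental[OF len] by (simp add: embed_isl prod_eq_iff fst_sum)
  qed
  ultimately show ?thesis using algP algL by (simp add: leibniz_action_def Let_def)
qed

section \<open>Nesting and the total bracket\<close>

lemma nested_total_bracket_Inl:
  "length ls = k * (n - 1) + 1 \<Longrightarrow>
    nested_bracket n k (total_bracket bP bL act) (map Inl ls) = Inl (nested_bracket n k bL ls)"
proof (induction k arbitrary: ls)
  case 0
  then show ?case by (cases ls) auto
next
  case (Suc k)
  then show ?case
    using total_bracket_Inl[of bP bL act "take (n - 1) ls @ [nested_bracket n k bL (drop (n - 1) ls)]"]
    by (simp add: take_map drop_map)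
qed

lemma nested_total_bracket_Inr:
  "length qs = k * (n - 1) + 1 \<Longrightarrow>
    nested_bracket n k (total_bracket bP bL act) (map Inr qs) = Inr (nested_bracket n k bP qs)"
proof (induction k arbitrary: qs)
  case 0
  then show ?case by (cases qs) auto
next
  case (Suc k)
  then show ?case
    using total_bracket_Inr[of "take (n - 1) qs @ [nested_bracket n k bP (drop (n - 1) qs)]" bP bL act]
    by (simp add: take_map drop_map)
qed

text \<open>Nesting commutes with \<open>Inl\<close> and \<open>Inr\<close> on pure lists. On mixed
  lists the nested bracket lies in L by \<open>grade_nested\<close>, so the \<open>projl\<close> in
  \<open>nested_action\<close> is undone by \<open>Inl\<close>.\<close>

lemma total_bracket_nested:
  assumes n: "n \<ge> 2" and act: "leibniz_action n sP bP sL bL act"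
    and len: "length xs = k * (n - 1) + 1"
  shows "total_bracket (nested_bracket n k bP) (nested_bracket n k bL) (nested_action n k bP bL act) xs
    = nested_bracket n k (total_bracket bP bL act) xs"
proof (cases rule: homogeneous_cases[of xs])
  case (L ls)
  then show ?thesis using len by (simp add: total_bracket_Inl nested_total_bracket_Inl)
next
  case (P qs)
  then show ?thesis
    using len by (subst P, subst total_bracket_Inr) (auto simp: nested_total_bracket_Inr)
next
  case mixed
  interpret graded_leibniz n "pair_scale sL sP" isl embed "total_bracket bP bL act"
    using n act by (rule graded_leibniz_total_bracket)
  have "isl (nested_bracket n k (total_bracket bP bL act) xs)"
    using mixed len by (auto simp: grade_nested mixed_def)
  then show ?thesis using mixed by (simp add: total_bracket_mixed nested_action_def)
qed

text \<open>The known fact that \<open>U\<^sub>n\<^sup>p\<close> yields Leibniz p-algebras, which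
  the notion of action in arity p presupposes; here it is the one-degree case.\<close>

lemma leibniz_algebra_nested:
  assumes "n \<ge> 2" "k \<ge> 1" "leibniz_algebra n s b"
  shows "leibniz_algebra (k * (n - 1) + 1) s (nested_bracket n k b)"
proof -
  interpret graded_leibniz n s "\<lambda>_. True" id b
    using assms by (simp add: leibniz_algebra_iff_graded)
  have "graded_leibniz (k * (n - 1) + 1) s (\<lambda>_. True) id (nested_bracket n k b)"
    using assms(2) by (rule graded_leibniz_nested)
  moreover from this have "k * (n - 1) + 1 \<ge> 2" by (rule graded_leibniz.arity)
  ultimately show ?thesis by (simp only: leibniz_algebra_iff_graded)
qed

theorem lemma4p2:
  fixes n k p :: nat
    and sP :: "'k::field \<Rightarrow> 'p::ab_group_add \<Rightarrow> 'p"
    and bP :: "'p list \<Rightarrow> 'p"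
    and sL :: "'k \<Rightarrow> 'l::ab_group_add \<Rightarrow> 'l"
    and bL :: "'l list \<Rightarrow> 'l"
    and act :: "('l + 'p) list \<Rightarrow> 'l"
  assumes "n \<ge> 2" and "k \<ge> 1" and "p = k * (n - 1) + 1"
    and "leibniz_algebra n sP bP" and "leibniz_algebra n sL bL"
    and "leibniz_action n sP bP sL bL act"
  shows "leibniz_action p sP (nested_bracket n k bP) sL (nested_bracket n k bL)
           (nested_action n k bP bL act)"
proof (rule leibniz_action_if_graded)
  show "leibniz_algebra p sP (nested_bracket n k bP)" "leibniz_algebra p sL (nested_bracket n k bL)"
    using assms by (simp_all only: leibniz_algebra_nested)
  \<comment> \<open>The semidirect product is nested first; \<open>total_bracket_nested\<close> then
    recognises the result as the total bracket of the nested data.\<close>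
  have "graded_leibniz p (pair_scale sL sP) isl embed (nested_bracket n k (total_bracket bP bL act))"
    unfolding assms(3)
    using assms(1,2,6)
    by (intro graded_leibniz.graded_leibniz_nested graded_leibniz_total_bracket)
  then show "graded_leibniz p (pair_scale sL sP) isl embed
      (total_bracket (nested_bracket n k bP) (nested_bracket n k bL) (nested_action n k bP bL act))"
    by (rule graded_leibniz_cong) (use total_bracket_nested assms in simp)
qed

end
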